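(* Let $\Omega\subset\mathbb{R}^3$ be a bounded regular domain, $a>0$, $\gamma\in(2,4)$. For each $\lambda>\lambda^*$ the functional $\Phi_\lambda$ does not have critical points other than $u=0$.
   Context: $\|u\|=(\int_\Omega|\nabla u|^2)^{1/2}$ is the norm on $H_0^1(\Omega)$, $\|u\|_\gamma$ the $L^\gamma(\Omega)$ norm. For $\lambda>0$, $\Phi_\lambda(u)=\frac a2\|u\|^2+\frac\lambda4\|u\|^4-\frac1\gamma\|u\|_\gamma^\gamma$ on $H_0^1(\Omega)$. $\lambda^*=\sup_{u\in H_0^1(\Omega)\setminus\{0\}}\lambda(u)$, where $\lambda(u)=C_{a,\gamma}\left(\frac{\|u\|_\gamma}{\|u\|}\right)^{\frac{2\gamma}{\gamma-2}}$ and $C_{a,\gamma}=a\,\frac{\gamma-2}{4-\gamma}\left(\frac{4-\gamma}{2a}\right)^{\frac2{\gamma-2}}$. *)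

theory Defs
  imports "HOL-Analysis.Analysis"
begin

definition gradient :: "(real^'n \<Rightarrow> real) \<Rightarrow> real^'n \<Rightarrow> real^'n" where
  "gradient f x = (\<chi> i. frechet_derivative f (at x) (axis i 1))"

primrec Ck :: "nat \<Rightarrow> (real^'n \<Rightarrow> real) \<Rightarrow> bool" where
  "Ck 0 f \<longleftrightarrow> continuous_on UNIV f"
| "Ck (Suc k) f \<longleftrightarrow> (\<forall>x. f differentiable (at x)) \<and> (\<forall>i. Ck k (\<lambda>x. gradient f x $ i))"

text \<open>A bounded domain with boundary of class \<open>C\<^sup>1\<close>: near each boundary point, \<open>\<Omega>\<close> is the
  sublevel set of a \<open>C\<^sup>1\<close> function without critical points. This is the least restrictive
  of the usual classical meanings of ``regular'' and includes smoother boundaries.\<close>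

definition bounded_regular_domain :: "(real^'n) set \<Rightarrow> bool" where
  "bounded_regular_domain \<Omega> \<longleftrightarrow>
     \<Omega> \<noteq> {} \<and> open \<Omega> \<and> connected \<Omega> \<and> bounded \<Omega> \<and>
     (\<forall>p \<in> frontier \<Omega>. \<exists>U \<rho>. open U \<and> p \<in> U \<and> Ck 1 \<rho> \<and>
        (\<forall>x\<in>U. gradient \<rho> x \<noteq> 0) \<and> \<Omega> \<inter> U = {x\<in>U. \<rho> x < 0})"

definition test_functions :: "(real^'n) set \<Rightarrow> (real^'n \<Rightarrow> real) set" where
  "test_functions \<Omega> =
     {\<phi>. (\<forall>k. Ck k \<phi>) \<and> compact (closure {x. \<phi> x \<noteq> 0}) \<and> closure {x. \<phi> x \<noteq> 0} \<subseteq> \<Omega>}"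

text \<open>Elements of the function spaces are represented by functions on the whole space of which
  only the values on \<open>\<Omega>\<close>, up to null sets, matter.\<close>

definition L2 :: "(real^'n) set \<Rightarrow> (real^'n \<Rightarrow> 'b::euclidean_space) set" where
  "L2 \<Omega> = {u \<in> borel_measurable (lebesgue_on \<Omega>). integrable (lebesgue_on \<Omega>) (\<lambda>x. (norm (u x))\<^sup>2)}"

definition zero_on :: "(real^'n) set \<Rightarrow> (real^'n \<Rightarrow> real) \<Rightarrow> bool" where
  "zero_on \<Omega> u \<longleftrightarrow> (AE x in lebesgue_on \<Omega>. u x = 0)"

definition has_weak_gradient ::
  "(real^'n) set \<Rightarrow> (real^'n \<Rightarrow> real) \<Rightarrow> (real^'n \<Rightarrow> real^'n) \<Rightarrow> bool" where
  "has_weak_gradient \<Omega> u g \<longleftrightarrow> u \<in> L2 \<Omega> \<and> g \<in> L2 \<Omega> \<and>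
     (\<forall>\<phi> \<in> test_functions \<Omega>. \<forall>i.
        (\<integral>x. u x * gradient \<phi> x $ i \<partial>lebesgue_on \<Omega>) = - (\<integral>x. g x $ i * \<phi> x \<partial>lebesgue_on \<Omega>))"

text \<open>The weak gradient is unique up to null sets, so the choice below is immaterial.\<close>

definition weak_grad :: "(real^'n) set \<Rightarrow> (real^'n \<Rightarrow> real) \<Rightarrow> real^'n \<Rightarrow> real^'n" where
  "weak_grad \<Omega> u = (SOME g. has_weak_gradient \<Omega> u g)"

definition H1 :: "(real^'n) set \<Rightarrow> (real^'n \<Rightarrow> real) set" where
  "H1 \<Omega> = {u. \<exists>g. has_weak_gradient \<Omega> u g}"

text \<open>The closure of the test functions in the norm of \<open>H\<^sup>1\<close>.\<close>

definition H01 :: "(real^'n) set \<Rightarrow> (real^'n \<Rightarrow> real) set" where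
  "H01 \<Omega> = {u \<in> H1 \<Omega>. \<forall>\<epsilon>>0. \<exists>\<phi> \<in> test_functions \<Omega>.
     (\<integral>x. (u x - \<phi> x)\<^sup>2 \<partial>lebesgue_on \<Omega>) +
     (\<integral>x. (norm (weak_grad \<Omega> u x - gradient \<phi> x))\<^sup>2 \<partial>lebesgue_on \<Omega>) < \<epsilon>}"

definition H01_norm :: "(real^'n) set \<Rightarrow> (real^'n \<Rightarrow> real) \<Rightarrow> real" where
  "H01_norm \<Omega> u = sqrt (\<integral>x. (norm (weak_grad \<Omega> u x))\<^sup>2 \<partial>lebesgue_on \<Omega>)"

definition Lp_norm :: "(real^'n) set \<Rightarrow> real \<Rightarrow> (real^'n \<Rightarrow> real) \<Rightarrow> real" where
  "Lp_norm \<Omega> p u = (\<integral>x. \<bar>u x\<bar> powr p \<partial>lebesgue_on \<Omega>) powr (1 / p)"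

definition Phi :: "(real^'n) set \<Rightarrow> real \<Rightarrow> real \<Rightarrow> real \<Rightarrow> (real^'n \<Rightarrow> real) \<Rightarrow> real" where
  "Phi \<Omega> a \<gamma> lam u = a / 2 * (H01_norm \<Omega> u)\<^sup>2 + lam / 4 * (H01_norm \<Omega> u) ^ 4
     - 1 / \<gamma> * (Lp_norm \<Omega> \<gamma> u) powr \<gamma>"

text \<open>\<open>L\<close> is the Frechet derivative at \<open>u\<close> of a functional \<open>F\<close> on the space \<open>H01 \<Omega>\<close>
  normed by \<open>H01_norm \<Omega>\<close>.\<close>

definition has_H01_derivative ::
  "(real^'n) set \<Rightarrow> ((real^'n \<Rightarrow> real) \<Rightarrow> real) \<Rightarrow> ((real^'n \<Rightarrow> real) \<Rightarrow> real) \<Rightarrow>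
   (real^'n \<Rightarrow> real) \<Rightarrow> bool" where
  "has_H01_derivative \<Omega> F L u \<longleftrightarrow>
     (\<forall>v\<in>H01 \<Omega>. \<forall>w\<in>H01 \<Omega>. \<forall>c d. L (\<lambda>x. c * v x + d * w x) = c * L v + d * L w) \<and>
     (\<exists>K. \<forall>v\<in>H01 \<Omega>. \<bar>L v\<bar> \<le> K * H01_norm \<Omega> v) \<and>
     (\<forall>\<epsilon>>0. \<exists>\<delta>>0. \<forall>h\<in>H01 \<Omega>. H01_norm \<Omega> h < \<delta> \<longrightarrow>
        \<bar>F (\<lambda>x. u x + h x) - F u - L h\<bar> \<le> \<epsilon> * H01_norm \<Omega> h)"

definition critical_point ::
  "(real^'n) set \<Rightarrow> ((real^'n \<Rightarrow> real) \<Rightarrow> real) \<Rightarrow> (real^'n \<Rightarrow> real) \<Rightarrow> bool" where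
  "critical_point \<Omega> F u \<longleftrightarrow> u \<in> H01 \<Omega> \<and> has_H01_derivative \<Omega> F (\<lambda>h. 0) u"

definition C_const :: "real \<Rightarrow> real \<Rightarrow> real" where
  "C_const a \<gamma> = a * ((\<gamma> - 2) / (4 - \<gamma>)) * ((4 - \<gamma>) / (2 * a)) powr (2 / (\<gamma> - 2))"

definition lambda_of :: "(real^'n) set \<Rightarrow> real \<Rightarrow> real \<Rightarrow> (real^'n \<Rightarrow> real) \<Rightarrow> real" where
  "lambda_of \<Omega> a \<gamma> u =
     C_const a \<gamma> * (Lp_norm \<Omega> \<gamma> u / H01_norm \<Omega> u) powr (2 * \<gamma> / (\<gamma> - 2))"

text \<open>The supremum is taken in \<open>ereal\<close>, so that it is the least upper bound without a prior
  proof of boundedness (in \<open>real\<close>, the supremum of an unbounded set is unspecified).\<close>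

definition lambda_star :: "(real^'n) set \<Rightarrow> real \<Rightarrow> real \<Rightarrow> ereal" where
  "lambda_star \<Omega> a \<gamma> = (SUP u \<in> {u \<in> H01 \<Omega>. \<not> zero_on \<Omega> u}. ereal (lambda_of \<Omega> a \<gamma> u))"

end

theory Submission
  imports Defs
begin

text \<open>Let \<open>u \<noteq> 0\<close> be a critical point, \<open>N = \<parallel>u\<parallel>\<close> and \<open>P = \<parallel>u\<parallel>\<^sub>\<gamma>\<^sup>\<gamma>\<close>. Differentiating
  \<open>\<Phi>\<^sub>\<lambda>(s u)\<close> at \<open>s = 1\<close> gives \<open>a N\<^sup>2 + \<lambda> N\<^sup>4 = P\<close>, and weighted AM-GM on the left-hand side
  turns this into \<open>\<lambda> \<le> \<lambda>(u) \<le> \<lambda>\<^sup>*\<close>. Uniqueness of weak gradients makes the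
  \<open>H\<^sub>0\<^sup>1\<close> norm homogeneous, and Poincare's inequality gives \<open>N > 0\<close>. If
  \<open>\<bar>u\<bar>\<^sup>\<gamma>\<close> were not integrable, the integral \<open>P\<close> would have the junk value \<open>0\<close>, contradicting
  \<open>a N\<^sup>2 + \<lambda> N\<^sup>4 > 0\<close>; so no Sobolev embedding enters.\<close>

subsection \<open>Smooth functions\<close>

lemma gradient_of_derivative:
  assumes "(f has_derivative D) (at x)"
  shows "gradient f x $ i = D (axis i 1)"
  using frechet_derivative_at[OF assms] by (simp add: gradient_def)

lemma differentiable_continuous_on_UNIV: "(\<And>x. f differentiable (at x)) \<Longrightarrow> continuous_on UNIV f"
  by (simp add: continuous_at_imp_continuous_on differentiable_imp_continuous_within)

lemma Ck_Suc_imp: "Ck (Suc k) f \<Longrightarrow> Ck k f"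
proof (induction k arbitrary: f)
  case 0
  then show ?case by (simp add: differentiable_continuous_on_UNIV)
next
  case (Suc k)
  then show ?case by (metis Ck.simps(2))
qed

lemma gradient_add:
  assumes "f differentiable (at x)" "g differentiable (at x)"
  shows "gradient (\<lambda>x. f x + g x) x $ i = gradient f x $ i + gradient g x $ i"
  using gradient_of_derivative[OF has_derivative_add[OF assms[unfolded frechet_derivative_works]]]
  by (simp add: gradient_def)

lemma gradient_mult:
  assumes "f differentiable (at x)" "g differentiable (at x)"
  shows "gradient (\<lambda>x. f x * g x) x $ i = f x * gradient g x $ i + gradient f x $ i * g x"
  using gradient_of_derivative[OF has_derivative_mult[OF assms[unfolded frechet_derivative_works]]]
  by (simp add: gradient_def)

lemma gradient_const: "gradient (\<lambda>x. c) x $ i = 0"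
  by (simp add: gradient_def)

lemma Ck_const: "Ck k (\<lambda>x. c)"
  by (induction k arbitrary: c) (simp_all add: gradient_const)

lemma Ck_add: "Ck k f \<Longrightarrow> Ck k g \<Longrightarrow> Ck k (\<lambda>x. f x + g x)"
  by (induction k arbitrary: f g)
    (simp_all add: gradient_add continuous_on_add)

lemma Ck_mult: "Ck k f \<Longrightarrow> Ck k g \<Longrightarrow> Ck k (\<lambda>x. f x * g x)"
proof (induction k arbitrary: f g)
  case 0
  then show ?case by (simp add: continuous_on_mult)
next
  case (Suc k)
  \<comment> \<open>The product rule leaves one factor undifferentiated, so each factor is needed at
    order \<open>k\<close> as well as \<open>Suc k\<close>.\<close>
  have "Ck k f" "Ck k g" using Suc.prems Ck_Suc_imp by blast+
  then show ?case using Suc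
    by (simp add: gradient_mult Ck_add)
qed

lemma Ck_prod:
  assumes "finite A" "\<And>a. a \<in> A \<Longrightarrow> Ck k (f a)"
  shows "Ck k (\<lambda>x. \<Prod>a\<in>A. f a x)"
  using assms by (induction A rule: finite_induct) (simp_all add: Ck_const Ck_mult)

text \<open>For \<open>P = 1\<close> this is the classical smooth function that is flat at 0.
  Allowing a polynomial factor in \<open>1 / y\<close> makes the family closed under
  differentiation, so smoothness of every member follows by a single induction.\<close>

definition flat_exp :: "real poly \<Rightarrow> real \<Rightarrow> real" where
  "flat_exp P y = (if y > 0 then poly P (1 / y) * exp (- (1 / y)) else 0)"

lemma poly_times_exp_minus_tendsto_0:
  fixes P :: "real poly"
  shows "((\<lambda>z. poly P z * exp (- z)) \<longlongrightarrow> 0) at_top"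
proof -
  have "((\<lambda>z. \<Sum>i\<le>degree P. coeff P i * (z ^ i / exp z)) \<longlongrightarrow> (\<Sum>i\<le>degree P. coeff P i * 0)) at_top"
    by (intro tendsto_sum tendsto_mult tendsto_const tendsto_power_div_exp_0)
  moreover have "(\<Sum>i\<le>degree P. coeff P i * (z ^ i / exp z)) = poly P z * exp (- z)" for z
    by (simp add: poly_altdef exp_minus sum_distrib_right divide_inverse mult.assoc)
  ultimately show ?thesis by simp
qed

text \<open>Differentiating \<open>P(1/y) e\<^bsup>-1/y\<^esup>\<close> gives \<open>Q(1/y) e\<^bsup>-1/y\<^esup>\<close> with \<open>Q(z) = z\<^sup>2 (P(z) - P'(z))\<close>.\<close>

lemma flat_exp_has_derivative:
  "(flat_exp P has_real_derivative flat_exp ([:0, 0, 1:] * (P - pderiv P)) y) (at y)"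
proof -
  consider "y > 0" | "y < 0" | "y = 0" by linarith
  then show ?thesis
  proof cases
    case 1
    have "((\<lambda>y. poly P (1 / y) * exp (- (1 / y))) has_real_derivative
       flat_exp ([:0, 0, 1:] * (P - pderiv P)) y) (at y)"
      using 1 by (auto intro!: derivative_eq_intros poly_DERIV[THEN DERIV_chain2]
          simp: flat_exp_def field_simps power2_eq_square)
    moreover have "\<forall>\<^sub>F x in nhds y. flat_exp P x = poly P (1 / x) * exp (- (1 / x))"
      using eventually_nhds_in_open[of "{0<..}" y] 1
      by (auto elim!: eventually_mono simp: flat_exp_def)
    ultimately show ?thesis by (subst DERIV_cong_ev[OF refl _ refl])
  next
    case 2
    have "\<forall>\<^sub>F x in nhds y. flat_exp P x = 0"
      using eventually_nhds_in_open[of "{..<0}" y] 2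
      by (auto elim!: eventually_mono simp: flat_exp_def)
    moreover have "((\<lambda>y. 0) has_real_derivative flat_exp ([:0, 0, 1:] * (P - pderiv P)) y) (at y)"
      using 2 by (simp add: flat_exp_def)
    ultimately show ?thesis by (subst DERIV_cong_ev[OF refl _ refl])
  next
    case 3
    \<comment> \<open>With \<open>z = 1 / h\<close> the right difference quotient at 0 is
      \<open>z * poly P z * exp (- z)\<close>, where the extra factor \<open>z\<close> comes from
      dividing by \<open>h\<close>; the left quotient is identically 0.\<close>
    have "((\<lambda>h. poly ([:0, 1:] * P) (inverse h) * exp (- inverse h)) \<longlongrightarrow> 0) (at_right 0)"
      using filterlim_compose[OF poly_times_exp_minus_tendsto_0 filterlim_inverse_at_top_right] .
    moreover have "\<forall>\<^sub>F h in at_right 0. poly ([:0, 1:] * P) (inverse h) * exp (- inverse h) = flat_exp P h / h"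
      using eventually_at_right_less[of "0::real"]
      by eventually_elim (simp add: flat_exp_def field_simps)
    ultimately have "((\<lambda>h. flat_exp P h / h) \<longlongrightarrow> 0) (at_right 0)"
      by (rule Lim_transform_eventually)
    moreover have "((\<lambda>h. flat_exp P h / h) \<longlongrightarrow> 0) (at_left 0)"
      by (rule Lim_transform_eventually[OF tendsto_const])
        (auto simp: flat_exp_def eventually_at_filter intro!: always_eventually)
    ultimately have "((\<lambda>h. flat_exp P h / h) \<longlongrightarrow> 0) (at 0)"
      by (simp add: filterlim_split_at)
    then show ?thesis
      using 3 by (simp add: DERIV_def flat_exp_def)
  qed
qed

lemma coordinate_compose_has_derivative:
  assumes "(h has_real_derivative h') (at (c * x $ i + b))"
  shows "((\<lambda>x::real^'n. h (c * x $ i + b)) has_derivative (\<lambda>v. h' * (c * v $ i))) (at x)"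
proof -
  have "((\<lambda>x::real^'n. c * x $ i + b) has_derivative (\<lambda>v. c * v $ i)) (at x)"
    by (auto intro!: derivative_eq_intros bounded_linear_imp_has_derivative)
  from has_derivative_compose[OF this assms[unfolded has_field_derivative_def]]
  show ?thesis .
qed

text \<open>Each partial derivative is a constant times another \<open>flat_exp\<close> at the same
  affine argument, so the induction generalises over \<open>P\<close>. The affine form covers both
  kinds of factor in a bump: distance to a lower face and to an upper face.\<close>

lemma Ck_flat_exp: "Ck k (\<lambda>x::real^'n. flat_exp P (c * x $ i + b))"
proof (induction k arbitrary: P)
  case 0
  have "isCont (\<lambda>x::real^'n. flat_exp P (c * x $ i + b)) x" for x
    using coordinate_compose_has_derivative[OF flat_exp_has_derivative] has_derivative_continuous by blast
  then show ?case by (simp add: continuous_at_imp_continuous_on)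
next
  case (Suc k)
  note D = coordinate_compose_has_derivative[OF flat_exp_has_derivative]
  show ?case
    unfolding Ck.simps gradient_of_derivative[OF D]
    using differentiableI[OF D]
    by (auto intro!: Ck_mult Suc.IH Ck_const)
qed

subsection \<open>Test functions and the fundamental lemma\<close>

lemma test_functions_Ck: "\<phi> \<in> test_functions \<Omega> \<Longrightarrow> Ck k \<phi>"
  by (simp add: test_functions_def)

lemma test_functions_continuous: "\<phi> \<in> test_functions \<Omega> \<Longrightarrow> continuous_on UNIV \<phi>"
  using test_functions_Ck[of \<phi> \<Omega> 0] by simp

lemma test_functions_differentiable: "\<phi> \<in> test_functions \<Omega> \<Longrightarrow> \<phi> differentiable (at x)"
  using test_functions_Ck[of \<phi> \<Omega> 1] by simp

lemma test_functions_gradient_continuous: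
  "\<phi> \<in> test_functions \<Omega> \<Longrightarrow> continuous_on UNIV (\<lambda>x. gradient \<phi> x $ i)"
  using test_functions_Ck[of \<phi> \<Omega> 1] by simp

lemma test_functions_gradient_continuous_vec:
  assumes "\<phi> \<in> test_functions \<Omega>"
  shows "continuous_on UNIV (gradient \<phi>)"
proof -
  have "continuous_on UNIV (\<lambda>x. \<chi> i. gradient \<phi> x $ i)"
    by (intro continuous_on_vec_lambda test_functions_gradient_continuous[OF assms])
  then show ?thesis by simp
qed

lemma test_functions_zero_outside: "\<phi> \<in> test_functions \<Omega> \<Longrightarrow> x \<notin> \<Omega> \<Longrightarrow> \<phi> x = 0"
  using closure_subset[of "{x. \<phi> x \<noteq> 0}"] by (auto simp: test_functions_def)

lemma test_functions_cmult:
  assumes "\<phi> \<in> test_functions \<Omega>"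
  shows "(\<lambda>x. c * \<phi> x) \<in> test_functions \<Omega>"
proof -
  \<comment> \<open>Only an inclusion holds in general, since the support becomes empty for
    \<open>c = 0\<close>.\<close>
  have "closure {x. c * \<phi> x \<noteq> 0} \<subseteq> closure {x. \<phi> x \<noteq> 0}"
    by (rule closure_mono) auto
  moreover from this have "compact (closure {x. c * \<phi> x \<noteq> 0})"
    using assms compact_Int_closed[of "closure {x. \<phi> x \<noteq> 0}" "closure {x. c * \<phi> x \<noteq> 0}"]
    by (simp add: test_functions_def Int_absorb1)
  ultimately show ?thesis
    using assms by (auto simp: test_functions_def intro!: Ck_mult Ck_const)
qed

lemma gradient_cmult:
  assumes "\<phi> \<in> test_functions \<Omega>"
  shows "gradient (\<lambda>x. c * \<phi> x) x = c *\<^sub>R gradient \<phi> x"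
  using gradient_mult[of "\<lambda>x. c" x \<phi>] test_functions_differentiable[OF assms]
  by (simp add: vec_eq_iff gradient_const)

text \<open>A smooth function that is positive exactly on the open box. The factor
  \<open>Suc m\<close> steepens the walls: inside the box every argument tends to infinity with
  \<open>m\<close>, where \<open>flat_exp 1\<close> tends to 1, so the bumps converge pointwise to
  the indicator of the box.\<close>

definition bump :: "real^'n \<Rightarrow> real^'n \<Rightarrow> nat \<Rightarrow> real^'n \<Rightarrow> real" where
  "bump p q m x = (\<Prod>i\<in>UNIV. flat_exp 1 (real (Suc m) * (x $ i - p $ i))
     * flat_exp 1 (real (Suc m) * (q $ i - x $ i)))"

lemma flat_exp_1_bounds: "0 \<le> flat_exp 1 y" "flat_exp 1 y \<le> 1"
  by (auto simp: flat_exp_def)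

lemma bump_bounds: "0 \<le> bump p q m x" "bump p q m x \<le> 1"
  unfolding bump_def
  by (auto intro!: prod_nonneg prod_le_1 mult_nonneg_nonneg mult_le_one flat_exp_1_bounds)

lemma bump_nonzero_iff: "bump p q m x \<noteq> 0 \<longleftrightarrow> x \<in> box p q"
  by (auto simp: bump_def flat_exp_def mem_box_cart zero_less_mult_iff split: if_splits)

lemma flat_exp_1_tendsto:
  assumes "y > 0"
  shows "(\<lambda>m. flat_exp 1 (real (Suc m) * y)) \<longlonglongrightarrow> 1"
proof -
  have "(\<lambda>m. exp (- (inverse (real (Suc m)) * inverse y))) \<longlonglongrightarrow> exp (- (0 * inverse y))"
    by (intro tendsto_intros LIMSEQ_inverse_real_of_nat)
  then show ?thesis using assms
    by (simp add: flat_exp_def zero_less_mult_iff inverse_eq_divide)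
qed

lemma bump_tendsto:
  fixes p q x :: "real^'n"
  shows "(\<lambda>m. bump p q m x) \<longlonglongrightarrow> indicator (box p q) x"
proof (cases "x \<in> box p q")
  case True
  then have "(\<lambda>m. bump p q m x) \<longlonglongrightarrow> (\<Prod>i\<in>(UNIV::'n set). 1 * 1)"
    unfolding bump_def
    by - (intro tendsto_prod tendsto_mult flat_exp_1_tendsto, auto simp: mem_box_cart)
  with True show ?thesis by simp
next
  case False
  then have "bump p q m x = 0" for m using bump_nonzero_iff by blast
  with False show ?thesis by simp
qed

text \<open>Positivity holds only on the open box, but the support may reach its faces, hence the
  hypothesis on the closed box.\<close>

lemma bump_test_function:
  assumes "cbox p q \<subseteq> \<Omega>"
  shows "bump p q m \<in> test_functions \<Omega>"
proof -
  have "closure {x. bump p q m x \<noteq> 0} \<subseteq> cbox p q"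
    unfolding bump_nonzero_iff Collect_mem_eq by (rule closure_minimal[OF box_subset_cbox closed_cbox])
  moreover from this have "compact (closure {x. bump p q m x \<noteq> 0})"
    using compact_Int_closed[OF compact_cbox, of "closure {x. bump p q m x \<noteq> 0}" p q]
    by (simp add: Int_absorb1)
  moreover have "Ck k (bump p q m)" for k
  proof -
    have "Ck k (\<lambda>x. flat_exp 1 (real (Suc m) * (x $ i - p $ i)))"
      "Ck k (\<lambda>x. flat_exp 1 (real (Suc m) * (q $ i - x $ i)))" for i
      using Ck_flat_exp[of k 1 "real (Suc m)" i "- real (Suc m) * p $ i"]
        Ck_flat_exp[of k 1 "- real (Suc m)" i "real (Suc m) * q $ i"]
      by (simp_all add: algebra_simps)
    then have "Ck k (\<lambda>x. bump p q m x)"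
      unfolding bump_def by (intro Ck_prod Ck_mult) simp_all
    then show ?thesis by simp
  qed
  ultimately show ?thesis using assms by (auto simp: test_functions_def)
qed

text \<open>Inside a fixed box, the Borel sets over which \<open>g\<close> integrates to 0 form a
  Dynkin system containing the boxes. These are stable under intersection and generate the Borel
  sets, so all integrals vanish and \<open>g = 0\<close> almost everywhere there. Countably many
  boxes then exhaust \<open>\<Omega>\<close>.\<close>

lemma AE_zero_if_box_integrals_zero:
  fixes g :: "'a::euclidean_space \<Rightarrow> real"
  assumes g: "integrable lborel g" and "open \<Omega>"
    and zero: "\<And>p q. cbox p q \<subseteq> \<Omega> \<Longrightarrow> (\<integral>x. indicator (box p q) x * g x \<partial>lborel) = 0"
  shows "AE x in lborel. x \<in> \<Omega> \<longrightarrow> g x = 0"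
proof -
  have int: "integrable lborel (\<lambda>x. indicator A x * g x)" if "A \<in> sets borel" for A
    using g that integrable_real_mult_indicator[of A lborel g] by (simp add: mult.commute)
  have on_box: "AE x in lborel. indicator (box p q) x * g x = 0" if pq: "cbox p q \<subseteq> \<Omega>" for p q
  proof (rule sigma_finite_measure.density_zero[OF sigma_finite_lborel])
    show "integrable lborel (\<lambda>x. indicator (box p q) x * g x)" by (rule int) simp
    fix A :: "'a set" assume "A \<in> sets lborel"
    then have A: "A \<in> sigma_sets UNIV (range (\<lambda>(a, b). box a b))"
      by (simp add: borel_eq_box)
    have "Int_stable (range (\<lambda>(a, b). box a b :: 'a set))"
      by (auto simp: Int_stable_def box_Int_box)
    moreover have "range (\<lambda>(a, b). box a b :: 'a set) \<subseteq> Pow UNIV" by simp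
    ultimately have "(\<integral>x. indicator (A \<inter> box p q) x * g x \<partial>lborel) = 0"
      using A
    proof (induction rule: sigma_sets_induct_disjoint)
      case (basic A)
      then obtain a b where A: "A = box a b" by auto
      obtain c d where cd: "box a b \<inter> box p q = box c d"
        by (rule that, rule box_Int_box)
      \<comment> \<open>The case split is needed because an empty \<open>box c d\<close> may have a
        nonempty \<open>cbox c d\<close> lying outside \<open>\<Omega>\<close>. For a nonempty open
        box the closed box is its closure and stays inside \<open>cbox p q\<close>.\<close>
      show ?case
      proof (cases "box c d = {}")
        case False
        then have "cbox c d = closure (box c d)" by (simp add: closure_box)
        also have "\<dots> \<subseteq> cbox p q"
          using cd box_subset_cbox[of p q] by (intro closure_minimal) auto
        finally have "cbox c d \<subseteq> \<Omega>" using pq by blast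
        then show ?thesis using zero[of c d] A cd by simp
      qed (use A cd in simp)
    next
      case empty
      show ?case by simp
    next
      case (compl A)
      then have A: "A \<in> sets borel" by (simp add: borel_eq_box)
      have "(\<integral>x. indicator ((UNIV - A) \<inter> box p q) x * g x \<partial>lborel)
          = (\<integral>x. indicator (box p q) x * g x - indicator (A \<inter> box p q) x * g x \<partial>lborel)"
        by (intro Bochner_Integration.integral_cong) (auto simp: indicator_def)
      also have "\<dots> = 0"
        using A compl zero[OF pq] by (subst Bochner_Integration.integral_diff) (auto intro!: int)
      finally show ?case .
    next
      case (union A)
      then have A: "A i \<in> sets borel" for i by (auto simp: borel_eq_box)
      have "(LINT x:(\<Union>i. A i \<inter> box p q)|lborel. g x) = (\<Sum>i. LINT x:(A i \<inter> box p q)|lborel. g x)"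
      proof (rule lebesgue_integral_countable_add)
        show "set_integrable lborel (\<Union>i. A i \<inter> box p q) g"
          using A by (auto simp: set_integrable_def intro!: int)
      qed (use A union(1) in \<open>auto simp: disjoint_family_on_def\<close>)
      also have "\<dots> = 0"
        using union by (simp add: set_lebesgue_integral_def)
      finally show ?case by (simp add: set_lebesgue_integral_def)
    qed
    then show "(LINT x:A|lborel. indicator (box p q) x * g x) = 0"
      by (simp add: set_lebesgue_integral_def indicator_inter_arith mult.assoc)
  qed
  \<comment> \<open>The cover consists of closed boxes while \<open>on_box\<close> concerns open
    ones; the difference, the faces, is a null set.\<close>
  obtain \<D> :: "'a set set" where "countable \<D>" "\<D> \<subseteq> Pow \<Omega>"
    and D: "\<forall>X\<in>\<D>. \<exists>a b. X = cbox a b" "\<Union>\<D> = \<Omega>"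
    by (rule open_countable_Union_open_cbox[OF \<open>open \<Omega>\<close>], rule that) auto
  have "AE x in lborel. x \<in> X \<longrightarrow> g x = 0" if X: "X \<in> \<D>" for X
  proof -
    obtain a b where ab: "X = cbox a b" using D X by blast
    then have "AE x in lborel. indicator (box a b) x * g x = 0"
      using \<open>\<D> \<subseteq> Pow \<Omega>\<close> X by (intro on_box) auto
    moreover have "AE x in lborel. x \<notin> cbox a b - box a b"
      by (intro AE_not_in)
        (simp add: null_sets_def emeasure_Diff box_subset_cbox emeasure_lborel_cbox_eq emeasure_lborel_box_eq)
    ultimately show ?thesis
      by eventually_elim (auto simp: ab)
  qed
  then have "AE x in lborel. \<forall>X\<in>\<D>. x \<in> X \<longrightarrow> g x = 0"
    unfolding AE_ball_countable[OF \<open>countable \<D>\<close>] by blast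
  then show ?thesis
    by (rule eventually_mono) (use D in blast)
qed

text \<open>Bumps are test functions that approximate indicators of boxes, which reduces the claim
  to vanishing integrals over boxes.\<close>

lemma fundamental_lemma_of_calculus_of_variations:
  fixes d :: "real^'n \<Rightarrow> real"
  assumes "open \<Omega>" and d: "integrable (lebesgue_on \<Omega>) d"
    and zero: "\<And>\<phi>. \<phi> \<in> test_functions \<Omega> \<Longrightarrow> (\<integral>x. d x * \<phi> x \<partial>lebesgue_on \<Omega>) = 0"
  shows "AE x in lebesgue_on \<Omega>. d x = 0"
proof -
  have \<Omega>: "\<Omega> \<in> sets lebesgue" using \<open>open \<Omega>\<close> by (simp add: borel_open)
  have D: "integrable lebesgue (\<lambda>x. indicator \<Omega> x * d x)"
    using d \<Omega> by (simp add: integrable_restrict_space)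
  \<comment> \<open>The argument with boxes works on Borel sets, so the Lebesgue measurable
    function, extended by 0 outside \<open>\<Omega>\<close>, is replaced by a Borel function equal
    to it almost everywhere.\<close>
  obtain g where g: "g \<in> borel_measurable lborel" and ae: "AE x in lborel. indicator \<Omega> x * d x = g x"
    using completion_ex_borel_measurable_real[of "\<lambda>x. indicator \<Omega> x * d x" lborel]
      borel_measurable_integrable[OF D] by blast
  have ae': "AE x in lebesgue. indicator \<Omega> x * d x = g x"
    using ae by (rule AE_completion)
  have gi: "integrable lborel g"
  proof -
    have "integrable lebesgue g"
      using D ae' g by (subst integrable_cong_AE[symmetric]) (auto simp: measurable_completion)
    then show ?thesis using g by (simp add: integrable_completion)
  qed
  have test: "(\<integral>x. g x * \<phi> x \<partial>lborel) = 0" if \<phi>: "\<phi> \<in> test_functions \<Omega>" for \<phi>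
  proof -
    have [measurable]: "\<phi> \<in> borel_measurable lborel"
      using test_functions_continuous[OF \<phi>] by (simp add: borel_measurable_continuous_onI)
    note [measurable] = g
    have "(\<integral>x. g x * \<phi> x \<partial>lborel) = (\<integral>x. g x * \<phi> x \<partial>lebesgue)"
      by (rule integral_completion[symmetric]) measurable
    also have "\<dots> = (\<integral>x. (indicator \<Omega> x * d x) * \<phi> x \<partial>lebesgue)"
    proof (rule integral_cong_AE)
      show "(\<lambda>x. g x * \<phi> x) \<in> borel_measurable lebesgue"
        by (rule measurable_completion) measurable
      have "\<phi> \<in> borel_measurable lebesgue" by (rule measurable_completion) measurable
      with D show "(\<lambda>x. indicator \<Omega> x * d x * \<phi> x) \<in> borel_measurable lebesgue"
        by (intro borel_measurable_times[OF borel_measurable_integrable])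
      show "AE x in lebesgue. g x * \<phi> x = indicator \<Omega> x * d x * \<phi> x"
        using ae' by eventually_elim simp
    qed
    also have "\<dots> = (\<integral>x. d x * \<phi> x \<partial>lebesgue_on \<Omega>)"
      using \<Omega> by (simp add: integral_restrict_space mult.assoc)
    finally show ?thesis using zero[OF \<phi>] by simp
  qed
  have "(\<integral>x. indicator (box p q) x * g x \<partial>lborel) = 0" if pq: "cbox p q \<subseteq> \<Omega>" for p q
  proof -
    have [measurable]: "bump p q m \<in> borel_measurable lborel" for m
      using test_functions_continuous[OF bump_test_function[OF pq]]
      by (simp add: borel_measurable_continuous_onI)
    note [measurable] = g
    \<comment> \<open>Bumps lie between 0 and 1, so \<open>\<bar>g x\<bar>\<close> dominates; every
      integral on the left is 0 by \<open>test\<close>.\<close>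
    have "(\<lambda>m. \<integral>x. g x * bump p q m x \<partial>lborel) \<longlonglongrightarrow> (\<integral>x. g x * indicator (box p q) x \<partial>lborel)"
    proof (rule integral_dominated_convergence[where w="\<lambda>x. \<bar>g x\<bar>"])
      show "AE x in lborel. (\<lambda>m. g x * bump p q m x) \<longlonglongrightarrow> g x * indicator (box p q) x"
        by (intro AE_I2 tendsto_intros bump_tendsto)
      show "AE x in lborel. norm (g x * bump p q m x) \<le> \<bar>g x\<bar>" for m
        using bump_bounds[of p q m] by (auto intro!: AE_I2 mult_left_le simp: abs_mult)
    qed (use gi in auto)
    then show ?thesis
      using test[OF bump_test_function[OF pq]] LIMSEQ_unique[OF _ tendsto_const]
      by (simp add: mult.commute)
  qed
  then have "AE x in lborel. x \<in> \<Omega> \<longrightarrow> g x = 0"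
    by (rule AE_zero_if_box_integrals_zero[OF gi \<open>open \<Omega>\<close>])
  then have "AE x in lborel. indicator \<Omega> x * d x = 0"
    using ae by eventually_elim (auto simp: indicator_def of_bool_def split: if_splits)
  then have "AE x in lebesgue. x \<in> \<Omega> \<longrightarrow> d x = 0"
    by (rule AE_completion[OF eventually_mono]) (simp add: indicator_def)
  then show ?thesis using \<Omega> by (simp add: AE_restrict_space_iff)
qed

subsection \<open>Poincare's inequality for test functions\<close>

text \<open>By translation invariance of Lebesgue measure every difference quotient of
  \<open>f\<close> has integral 0, and these quotients converge to the partial derivative. This
  avoids iterated integration.\<close>

lemma integral_partial_derivative_zero:
  fixes f :: "real^'n \<Rightarrow> real"
  assumes f: "Ck 1 f" and supp: "\<And>x. R < norm x \<Longrightarrow> f x = 0"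
  shows "(\<integral>x. gradient f x $ i \<partial>lborel) = 0"
proof -
  have diff: "f differentiable (at x)" for x using f by simp
  have cont: "continuous_on UNIV f" using Ck_Suc_imp[of 0 f] f by simp
  have gcont: "continuous_on UNIV (\<lambda>x. gradient f x $ i)" using f by simp
  have [measurable]: "f \<in> borel_measurable borel" "(\<lambda>x. gradient f x $ i) \<in> borel_measurable borel"
    using cont gcont by (simp_all add: borel_measurable_continuous_onI)
  let ?e = "axis i 1 :: real^'n"
  have dir: "((\<lambda>t. f (x + t *\<^sub>R ?e)) has_real_derivative gradient f (x + t *\<^sub>R ?e) $ i) (at t)" for x t
  proof -
    have "((\<lambda>t. x + t *\<^sub>R ?e) has_derivative (\<lambda>s. s *\<^sub>R ?e)) (at t)"
      by (auto intro!: derivative_eq_intros)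
    from has_derivative_compose[OF this diff[unfolded frechet_derivative_works]]
    have "((\<lambda>t. f (x + t *\<^sub>R ?e)) has_derivative
        (\<lambda>s. frechet_derivative f (at (x + t *\<^sub>R ?e)) (s *\<^sub>R ?e))) (at t)" .
    moreover have "frechet_derivative f (at (x + t *\<^sub>R ?e)) (s *\<^sub>R ?e)
        = gradient f (x + t *\<^sub>R ?e) $ i * s" for s
      using linear_scale[OF linear_frechet_derivative[OF diff]] by (simp add: gradient_def mult.commute)
    ultimately show ?thesis by (simp add: has_field_derivative_def)
  qed
  \<comment> \<open>The mean value theorem is applied at points of norm at most \<open>R + 1\<close>
    with step at most 1, so intermediate points have norm at most \<open>R + 2\<close>.\<close>
  have "compact ((\<lambda>x. gradient f x $ i) ` cball 0 (R + 2))"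
    by (intro compact_continuous_image continuous_on_subset[OF gcont]) auto
  then obtain M where "\<forall>x\<in>cball 0 (R + 2). \<bar>gradient f x $ i\<bar> \<le> M"
    by (auto dest!: compact_imp_bounded simp: bounded_iff)
  then have M: "\<bar>gradient f x $ i\<bar> \<le> M" if "norm x \<le> R + 2" for x using that by simp
  define q where "q m x = (f (x + inverse (real (Suc m)) *\<^sub>R ?e) - f x) / inverse (real (Suc m))" for m x
  have fi: "integrable lborel f"
  proof -
    have "integrable lborel (\<lambda>x. indicator (cball 0 R) x *\<^sub>R f x)"
      by (rule borel_integrable_compact) (auto intro: continuous_on_subset[OF cont])
    moreover have "(\<lambda>x. indicator (cball 0 R) x *\<^sub>R f x) = f"
      using supp by (auto simp: fun_eq_iff indicator_def not_le)
    ultimately show ?thesis by simp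
  qed
  have shift: "integrable lborel (\<lambda>x. f (x + c))" "(\<integral>x. f (x + c) \<partial>lborel) = (\<integral>x. f x \<partial>lborel)" for c
    using integrable_distr_eq[of "(+) c" lborel borel f] integral_distr[of "(+) c" lborel borel f] fi
    by (simp_all add: lborel_distr_plus add.commute)
  have q0: "(\<integral>x. q m x \<partial>lborel) = 0" for m
    unfolding q_def using shift fi by simp
  \<comment> \<open>Dominated convergence: on the ball of radius \<open>R + 1\<close> the mean value
    theorem bounds the quotient by \<open>M\<close>, and outside it both values of \<open>f\<close>
    vanish because the step is at most 1.\<close>
  have "(\<lambda>m. \<integral>x. q m x \<partial>lborel) \<longlonglongrightarrow> (\<integral>x. gradient f x $ i \<partial>lborel)"
  proof (rule integral_dominated_convergence[where w="\<lambda>x. indicator (cball 0 (R + 1)) x * M"])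
    show "integrable lborel (\<lambda>x::real^'n. indicator (cball 0 (R + 1)) x * M)"
      by (intro integrable_mult_left integrable_real_indicator) (simp_all add: emeasure_compact_finite[unfolded infinity_ennreal_def])
    show "AE x in lborel. (\<lambda>m. q m x) \<longlonglongrightarrow> gradient f x $ i"
    proof (rule AE_I2)
      fix x
      have "(\<lambda>h. (f (x + h *\<^sub>R ?e) - f x) / h) \<midarrow>0\<rightarrow> gradient f x $ i"
        using dir[of x 0] by (simp add: DERIV_def)
      moreover have "filterlim (\<lambda>m. inverse (real (Suc m))) (at 0) sequentially"
        using LIMSEQ_inverse_real_of_nat by (simp add: filterlim_at)
      ultimately show "(\<lambda>m. q m x) \<longlonglongrightarrow> gradient f x $ i"
        unfolding q_def by (rule filterlim_compose)
    qed
    show "AE x in lborel. norm (q m x) \<le> indicator (cball 0 (R + 1)) x * M" for m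
    proof (rule AE_I2)
      fix x :: "real^'n"
      define h where "h = inverse (real (Suc m))"
      have h: "0 < h" "h \<le> 1" by (simp_all add: h_def field_simps)
      have qm: "q m x = (f (x + h *\<^sub>R ?e) - f x) / h" by (simp only: q_def h_def)
      have near: "\<bar>norm (x + z *\<^sub>R ?e) - norm x\<bar> \<le> 1" if "0 \<le> z" "z \<le> h" for z
        using norm_triangle_ineq3[of "x + z *\<^sub>R ?e" x] that h by simp
      show "norm (q m x) \<le> indicator (cball 0 (R + 1)) x * M"
      proof (cases "norm x \<le> R + 1")
        case True
        obtain z where z: "0 < z" "z < h"
          "f (x + h *\<^sub>R ?e) - f (x + 0 *\<^sub>R ?e) = (h - 0) * gradient f (x + z *\<^sub>R ?e) $ i"
          using MVT2[OF h(1), of "\<lambda>t. f (x + t *\<^sub>R ?e)" "\<lambda>t. gradient f (x + t *\<^sub>R ?e) $ i"] dir by blast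
        have "\<bar>gradient f (x + z *\<^sub>R ?e) $ i\<bar> \<le> M"
          using near[of z] z True by (intro M) linarith
        then show ?thesis using z h True by (simp add: qm)
      next
        case False
        then have "f x = 0" "f (x + h *\<^sub>R ?e) = 0"
          using near[of h] h by (intro supp; linarith)+
        then show ?thesis using False by (simp add: qm)
      qed
    qed
  qed (simp_all add: q_def)
  then show ?thesis using LIMSEQ_unique[OF tendsto_const[of 0]] by (simp add: q0)
qed

lemma integrable_continuous_bounded_domain:
  fixes f :: "real^'n \<Rightarrow> 'b::euclidean_space"
  assumes "open \<Omega>" "bounded \<Omega>" "continuous_on UNIV f"
  shows "integrable (lebesgue_on \<Omega>) f"
proof -
  have "compact (f ` closure \<Omega>)"
    using assms by (intro compact_continuous_image continuous_on_subset[OF assms(3)]) auto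
  then obtain M where M: "\<forall>x\<in>closure \<Omega>. norm (f x) \<le> M"
    by (auto dest!: compact_imp_bounded simp: bounded_iff)
  have \<Omega>: "\<Omega> \<in> lmeasurable" using assms by (simp add: lmeasurable_open)
  then interpret finite_measure "lebesgue_on \<Omega>" by (rule finite_measure_lebesgue_on)
  show ?thesis
  proof (rule integrable_const_bound)
    show "AE x in lebesgue_on \<Omega>. norm (f x) \<le> M"
      using M closure_subset[of \<Omega>] by (intro AE_I2) auto
    show "f \<in> borel_measurable (lebesgue_on \<Omega>)"
      using assms continuous_on_subset
      by (auto intro!: continuous_imp_measurable_on_sets_lebesgue fmeasurableD[OF \<Omega>])
  qed
qed

text \<open>The divergence theorem applied to \<open>x\<^sub>i \<phi>\<^sup>2\<close> expresses the integral of \<open>\<phi>\<^sup>2\<close> by that of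
  \<open>-2 x\<^sub>i \<phi> \<partial>\<^sub>i\<phi>\<close>.\<close>

lemma poincare_test_functions:
  fixes \<Omega> :: "(real^'n) set"
  assumes "open \<Omega>" and R: "\<And>x. x \<in> \<Omega> \<Longrightarrow> norm x \<le> R" and \<phi>: "\<phi> \<in> test_functions \<Omega>"
  shows "(\<integral>x. (\<phi> x)\<^sup>2 \<partial>lebesgue_on \<Omega>) \<le> 4 * R\<^sup>2 * (\<integral>x. (norm (gradient \<phi> x))\<^sup>2 \<partial>lebesgue_on \<Omega>)"
proof -
  \<comment> \<open>Any coordinate direction serves.\<close>
  obtain i :: 'n where True by blast
  have bdd: "bounded \<Omega>" using R by (auto simp: bounded_iff)
  have \<Omega>: "\<Omega> \<in> sets lebesgue" using \<open>open \<Omega>\<close> by (simp add: borel_open)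
  note diff = test_functions_differentiable[OF \<phi>]
  note cont = test_functions_continuous[OF \<phi>]
  note gcont = test_functions_gradient_continuous_vec[OF \<phi>]
  let ?f = "\<lambda>x. x $ i * (\<phi> x * \<phi> x)" and ?g = "\<lambda>x. gradient \<phi> x $ i"
  have coord: "((\<lambda>x::real^'n. x $ i) has_derivative (\<lambda>v. v $ i)) (at x)" for x
    by (auto intro!: bounded_linear_imp_has_derivative)
  have "Ck 1 (\<lambda>x::real^'n. x $ i)"
    using gradient_of_derivative[OF coord] differentiableI[OF coord] by simp
  then have "Ck 1 ?f" using test_functions_Ck[OF \<phi>] by (intro Ck_mult)
  moreover have "?f x = 0" if "R < norm x" for x
    using test_functions_zero_outside[OF \<phi>, of x] R[of x] that by fastforce
  ultimately have "(\<integral>x. gradient ?f x $ i \<partial>lborel) = 0"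
    by (rule integral_partial_derivative_zero)
  moreover have "gradient ?f x $ i = (\<phi> x)\<^sup>2 + 2 * (x $ i * \<phi> x * ?g x)" for x
    using diff by (subst gradient_mult) (auto simp: gradient_mult gradient_of_derivative[OF coord]
      differentiableI[OF coord] power2_eq_square algebra_simps)
  ultimately have "(\<integral>x. (\<phi> x)\<^sup>2 + 2 * (x $ i * \<phi> x * ?g x) \<partial>lborel) = 0" by simp
  moreover have fcont: "continuous_on UNIV (\<lambda>x. (\<phi> x)\<^sup>2 + 2 * (x $ i * \<phi> x * ?g x))"
    using cont gcont by (intro continuous_intros)
  then have [measurable]: "(\<lambda>x. (\<phi> x)\<^sup>2 + 2 * (x $ i * \<phi> x * ?g x)) \<in> borel_measurable lborel"
    by (simp add: borel_measurable_continuous_onI)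
  ultimately have "(\<integral>x. (\<phi> x)\<^sup>2 + 2 * (x $ i * \<phi> x * ?g x) \<partial>lebesgue) = 0"
    by (subst integral_completion) simp_all
  moreover have "(\<integral>x. (\<phi> x)\<^sup>2 + 2 * (x $ i * \<phi> x * ?g x) \<partial>lebesgue_on \<Omega>)
      = (\<integral>x. (\<phi> x)\<^sup>2 + 2 * (x $ i * \<phi> x * ?g x) \<partial>lebesgue)"
    using \<Omega> test_functions_zero_outside[OF \<phi>]
    by (subst integral_restrict_space) (auto intro!: Bochner_Integration.integral_cong simp: indicator_def)
  ultimately have zero: "(\<integral>x. (\<phi> x)\<^sup>2 + 2 * (x $ i * \<phi> x * ?g x) \<partial>lebesgue_on \<Omega>) = 0" by simp
  note integrable = integrable_continuous_bounded_domain[OF \<open>open \<Omega>\<close> bdd]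
  have int: "integrable (lebesgue_on \<Omega>) (\<lambda>x. (\<phi> x)\<^sup>2)"
    "integrable (lebesgue_on \<Omega>) (\<lambda>x. (norm (gradient \<phi> x))\<^sup>2)"
    "integrable (lebesgue_on \<Omega>) (\<lambda>x. (\<phi> x)\<^sup>2 + 2 * (x $ i * \<phi> x * ?g x))"
    using integrable[OF continuous_on_power[OF cont]]
      integrable[OF continuous_on_power[OF continuous_on_norm[OF gcont]]] integrable[OF fcont]
    by simp_all
  \<comment> \<open>With \<open>t = x $ i * ?g x\<close>, the square of
    \<open>\<phi> x + 2 * t\<close> being nonnegative bounds \<open>2 * \<phi> x * t\<close> below
    by minus \<open>\<phi>\<close> squared over 2 minus \<open>2 * t\<close> squared, and
    \<open>\<bar>t\<bar>\<close> is at most \<open>R * norm (gradient \<phi> x)\<close>. The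
    right-hand integral is 0, which yields the factor 4.\<close>
  have "(\<integral>x. (\<phi> x)\<^sup>2 / 2 - 2 * R\<^sup>2 * (norm (gradient \<phi> x))\<^sup>2 \<partial>lebesgue_on \<Omega>)
     \<le> (\<integral>x. (\<phi> x)\<^sup>2 + 2 * (x $ i * \<phi> x * ?g x) \<partial>lebesgue_on \<Omega>)"
  proof (rule integral_mono)
    fix x assume "x \<in> space (lebesgue_on \<Omega>)"
    then have "norm x \<le> R" using R by simp
    then have "\<bar>x $ i * ?g x\<bar> \<le> R * norm (gradient \<phi> x)"
      using component_le_norm_cart[of x i] component_le_norm_cart[of "gradient \<phi> x" i]
      by (auto simp: abs_mult intro!: mult_mono)
    then have "(x $ i * ?g x)\<^sup>2 \<le> (R * norm (gradient \<phi> x))\<^sup>2"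
      by (metis abs_ge_zero power2_abs power_mono)
    moreover have "0 \<le> (\<phi> x + 2 * (x $ i * ?g x))\<^sup>2" by simp
    ultimately show "(\<phi> x)\<^sup>2 / 2 - 2 * R\<^sup>2 * (norm (gradient \<phi> x))\<^sup>2
        \<le> (\<phi> x)\<^sup>2 + 2 * (x $ i * \<phi> x * ?g x)"
      by (simp add: power2_sum power_mult_distrib algebra_simps)
  qed (use int in simp_all)
  then show ?thesis using zero int by simp
qed

subsection \<open>The space \<open>H\<^sub>0\<^sup>1\<close>\<close>

lemma weak_grad_works:
  assumes "u \<in> H1 \<Omega>"
  shows "has_weak_gradient \<Omega> u (weak_grad \<Omega> u)"
  using assms someI_ex[of "has_weak_gradient \<Omega> u"] by (simp add: H1_def weak_grad_def)

lemma L2_component_mult_integrable: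
  fixes g :: "real^'n \<Rightarrow> real^'n"
  assumes "open \<Omega>" "bounded \<Omega>" and g: "g \<in> L2 \<Omega>" and \<phi>: "continuous_on UNIV \<phi>"
  shows "integrable (lebesgue_on \<Omega>) (\<lambda>x. g x $ i * \<phi> x :: real)"
proof (rule Bochner_Integration.integrable_bound)
  note int = integrable_continuous_bounded_domain[OF assms(1,2)]
  show "integrable (lebesgue_on \<Omega>) (\<lambda>x. (norm (g x))\<^sup>2 + (\<phi> x)\<^sup>2)"
    using g int[OF continuous_on_power[OF \<phi>]] by (simp add: L2_def)
  have "\<phi> \<in> borel_measurable (lebesgue_on \<Omega>)" using int[OF \<phi>] by simp
  moreover have "(\<lambda>x. g x $ i) \<in> borel_measurable (lebesgue_on \<Omega>)"
    unfolding cart_eq_inner_axis using g by (intro borel_measurable_inner) (simp_all add: L2_def)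
  ultimately show "(\<lambda>x. g x $ i * \<phi> x) \<in> borel_measurable (lebesgue_on \<Omega>)" by simp
  show "AE x in lebesgue_on \<Omega>. norm (g x $ i * \<phi> x) \<le> norm ((norm (g x))\<^sup>2 + (\<phi> x)\<^sup>2)"
  proof (rule AE_I2)
    fix x
    have "\<bar>g x $ i * \<phi> x\<bar> \<le> norm (g x) * \<bar>\<phi> x\<bar>"
      by (simp add: abs_mult component_le_norm_cart mult_right_mono)
    also have "\<dots> \<le> (norm (g x))\<^sup>2 + (\<phi> x)\<^sup>2"
      using sum_squares_bound[of "norm (g x)" "\<bar>\<phi> x\<bar>"] mult_nonneg_nonneg[of "norm (g x)" "\<bar>\<phi> x\<bar>"]
      by (simp del: mult_nonneg_nonneg)
    finally show "norm (g x $ i * \<phi> x) \<le> norm ((norm (g x))\<^sup>2 + (\<phi> x)\<^sup>2)" by simp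
  qed
qed

text \<open>Both gradients satisfy the same integral identity, so each component of their difference
  annihilates all test functions.\<close>

lemma weak_gradient_unique:
  assumes "open \<Omega>" "bounded \<Omega>" and g: "has_weak_gradient \<Omega> u g" and h: "has_weak_gradient \<Omega> u h"
  shows "AE x in lebesgue_on \<Omega>. g x = h x"
proof -
  have "AE x in lebesgue_on \<Omega>. g x $ i - h x $ i = 0" for i
  proof (rule fundamental_lemma_of_calculus_of_variations[OF \<open>open \<Omega>\<close>])
    have int: "integrable (lebesgue_on \<Omega>) (\<lambda>x. g x $ i * \<phi> x)"
      "integrable (lebesgue_on \<Omega>) (\<lambda>x. h x $ i * \<phi> x)" if "continuous_on UNIV \<phi>" for \<phi>
      using assms that by (auto simp: has_weak_gradient_def intro!: L2_component_mult_integrable)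
    show "integrable (lebesgue_on \<Omega>) (\<lambda>x. g x $ i - h x $ i)"
      using int[of "\<lambda>x. 1"] by simp
    fix \<phi> assume \<phi>: "\<phi> \<in> test_functions \<Omega>"
    then have "(\<integral>x. g x $ i * \<phi> x \<partial>lebesgue_on \<Omega>) = (\<integral>x. h x $ i * \<phi> x \<partial>lebesgue_on \<Omega>)"
      using g h unfolding has_weak_gradient_def by simp
    then show "(\<integral>x. (g x $ i - h x $ i) * \<phi> x \<partial>lebesgue_on \<Omega>) = 0"
      using int[OF test_functions_continuous[OF \<phi>]]
      unfolding left_diff_distrib by (subst Bochner_Integration.integral_diff) simp_all
  qed
  then have "AE x in lebesgue_on \<Omega>. \<forall>i\<in>UNIV. g x $ i - h x $ i = 0"
    by (intro AE_finite_allI) auto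
  then show ?thesis by eventually_elim (simp add: vec_eq_iff)
qed

lemma L2_scaleR: "u \<in> L2 \<Omega> \<Longrightarrow> (\<lambda>x. c *\<^sub>R u x) \<in> L2 \<Omega>"
  by (auto simp: L2_def power_mult_distrib)

lemma has_weak_gradient_cmult:
  assumes "has_weak_gradient \<Omega> u g"
  shows "has_weak_gradient \<Omega> (\<lambda>x. c * u x) (\<lambda>x. c *\<^sub>R g x)"
  using assms L2_scaleR[of u \<Omega> c] L2_scaleR[of g \<Omega> c]
  by (auto simp: has_weak_gradient_def mult.assoc)

text \<open>\<open>weak_grad\<close> is an arbitrary choice, so scaling commutes with it only almost
  everywhere, by uniqueness; this suffices under integrals.\<close>

lemma weak_grad_cmult:
  assumes "open \<Omega>" "bounded \<Omega>" "u \<in> H1 \<Omega>"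
  shows "AE x in lebesgue_on \<Omega>. weak_grad \<Omega> (\<lambda>x. c * u x) x = c *\<^sub>R weak_grad \<Omega> u x"
proof (rule weak_gradient_unique[OF assms(1,2)])
  show *: "has_weak_gradient \<Omega> (\<lambda>x. c * u x) (\<lambda>x. c *\<^sub>R weak_grad \<Omega> u x)"
    using has_weak_gradient_cmult weak_grad_works assms by blast
  then show "has_weak_gradient \<Omega> (\<lambda>x. c * u x) (weak_grad \<Omega> (\<lambda>x. c * u x))"
    by (intro weak_grad_works) (auto simp: H1_def)
qed

lemma weak_grad_measurable:
  assumes "u \<in> H1 \<Omega>"
  shows "weak_grad \<Omega> u \<in> borel_measurable (lebesgue_on \<Omega>)"
  using weak_grad_works[OF assms] by (simp add: has_weak_gradient_def L2_def)

lemma H1_cmult: "u \<in> H1 \<Omega> \<Longrightarrow> (\<lambda>x. c * u x) \<in> H1 \<Omega>"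
  using has_weak_gradient_cmult by (fastforce simp: H1_def)

lemma H01_norm_cmult:
  assumes "open \<Omega>" "bounded \<Omega>" "u \<in> H1 \<Omega>"
  shows "H01_norm \<Omega> (\<lambda>x. c * u x) = \<bar>c\<bar> * H01_norm \<Omega> u"
proof -
  have [measurable]: "weak_grad \<Omega> u \<in> borel_measurable (lebesgue_on \<Omega>)"
    "weak_grad \<Omega> (\<lambda>x. c * u x) \<in> borel_measurable (lebesgue_on \<Omega>)"
    using assms by (auto intro!: weak_grad_measurable H1_cmult)
  have "(\<integral>x. (norm (weak_grad \<Omega> (\<lambda>x. c * u x) x))\<^sup>2 \<partial>lebesgue_on \<Omega>)
      = (\<integral>x. c\<^sup>2 * (norm (weak_grad \<Omega> u x))\<^sup>2 \<partial>lebesgue_on \<Omega>)"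
  proof (rule integral_cong_AE)
    show "AE x in lebesgue_on \<Omega>. (norm (weak_grad \<Omega> (\<lambda>x. c * u x) x))\<^sup>2
        = c\<^sup>2 * (norm (weak_grad \<Omega> u x))\<^sup>2"
      using weak_grad_cmult[OF assms, of c] by eventually_elim (simp add: power_mult_distrib)
  qed simp_all
  then show ?thesis by (simp add: H01_norm_def real_sqrt_mult)
qed

text \<open>The derivative in \<open>has_H01_derivative\<close> tests only increments in
  \<open>H01 \<Omega>\<close>; this makes multiples of \<open>u\<close> admissible increments.
  Scaled approximants of \<open>u\<close> approximate the scaled function.\<close>

lemma H01_cmult:
  assumes "open \<Omega>" "bounded \<Omega>" "u \<in> H01 \<Omega>"
  shows "(\<lambda>x. c * u x) \<in> H01 \<Omega>"
proof -
  have H1: "u \<in> H1 \<Omega>" using assms by (simp add: H01_def)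
  have "\<exists>\<psi>\<in>test_functions \<Omega>. (\<integral>x. (c * u x - \<psi> x)\<^sup>2 \<partial>lebesgue_on \<Omega>) +
     (\<integral>x. (norm (weak_grad \<Omega> (\<lambda>x. c * u x) x - gradient \<psi> x))\<^sup>2 \<partial>lebesgue_on \<Omega>) < \<epsilon>" if "\<epsilon> > 0" for \<epsilon>
  proof -
    \<comment> \<open>Adding 1 in the denominator covers \<open>c = 0\<close> and makes the final
      estimate strict.\<close>
    have "\<epsilon> / (c\<^sup>2 + 1) > 0" using \<open>\<epsilon> > 0\<close> by (simp add: add_nonneg_pos)
    then obtain \<phi> where \<phi>: "\<phi> \<in> test_functions \<Omega>" and
      lt: "(\<integral>x. (u x - \<phi> x)\<^sup>2 \<partial>lebesgue_on \<Omega>) +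
        (\<integral>x. (norm (weak_grad \<Omega> u x - gradient \<phi> x))\<^sup>2 \<partial>lebesgue_on \<Omega>) < \<epsilon> / (c\<^sup>2 + 1)" (is "?A + ?B < _")
      using assms(3) unfolding H01_def by blast
    have [measurable]: "gradient \<phi> \<in> borel_measurable (lebesgue_on \<Omega>)"
      using integrable_continuous_bounded_domain[OF assms(1,2) test_functions_gradient_continuous_vec[OF \<phi>]]
      by simp
    have [measurable]: "weak_grad \<Omega> u \<in> borel_measurable (lebesgue_on \<Omega>)"
      "weak_grad \<Omega> (\<lambda>x. c * u x) \<in> borel_measurable (lebesgue_on \<Omega>)"
      using H1 by (auto intro!: weak_grad_measurable H1_cmult)
    have "(\<integral>x. (norm (weak_grad \<Omega> (\<lambda>x. c * u x) x - c *\<^sub>R gradient \<phi> x))\<^sup>2 \<partial>lebesgue_on \<Omega>)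
      = (\<integral>x. c\<^sup>2 * (norm (weak_grad \<Omega> u x - gradient \<phi> x))\<^sup>2 \<partial>lebesgue_on \<Omega>)"
    proof (rule integral_cong_AE)
      show "AE x in lebesgue_on \<Omega>. (norm (weak_grad \<Omega> (\<lambda>x. c * u x) x - c *\<^sub>R gradient \<phi> x))\<^sup>2
          = c\<^sup>2 * (norm (weak_grad \<Omega> u x - gradient \<phi> x))\<^sup>2"
        using weak_grad_cmult[OF assms(1,2) H1, of c]
        by eventually_elim (simp add: power_mult_distrib flip: scaleR_diff_right)
    qed simp_all
    moreover have "(\<integral>x. (c * u x - c * \<phi> x)\<^sup>2 \<partial>lebesgue_on \<Omega>) = c\<^sup>2 * ?A"
      by (simp add: power_mult_distrib flip: right_diff_distrib)
    ultimately have "(\<integral>x. (c * u x - c * \<phi> x)\<^sup>2 \<partial>lebesgue_on \<Omega>) +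
      (\<integral>x. (norm (weak_grad \<Omega> (\<lambda>x. c * u x) x - c *\<^sub>R gradient \<phi> x))\<^sup>2 \<partial>lebesgue_on \<Omega>) = c\<^sup>2 * (?A + ?B)"
      by (simp add: distrib_left)
    also have "\<dots> \<le> c\<^sup>2 * (\<epsilon> / (c\<^sup>2 + 1))"
      using lt by (intro mult_left_mono) auto
    also have "\<dots> < \<epsilon>" using \<open>\<epsilon> > 0\<close> by (simp add: divide_simps add_nonneg_pos)
    finally show ?thesis
      using test_functions_cmult[OF \<phi>, of c] gradient_cmult[OF \<phi>] by (intro bexI) auto
  qed
  then show ?thesis using H1_cmult[OF H1] by (simp add: H01_def)
qed

text \<open>The weak gradient vanishes, so approximating test functions have small gradients.
  Poincare's inequality makes them small in the mean square, and \<open>u\<close>, being close to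
  them, has mean square 0.\<close>

lemma H01_norm_zero_imp_zero_on:
  assumes "open \<Omega>" "bounded \<Omega>" "u \<in> H01 \<Omega>" and norm0: "H01_norm \<Omega> u = 0"
  shows "zero_on \<Omega> u"
proof -
  note int = integrable_continuous_bounded_domain[OF assms(1,2)]
  obtain R where R: "\<And>x. x \<in> \<Omega> \<Longrightarrow> norm x \<le> R" using \<open>bounded \<Omega>\<close> by (auto simp: bounded_iff)
  have H1: "u \<in> H1 \<Omega>" using assms by (simp add: H01_def)
  have u: "u \<in> borel_measurable (lebesgue_on \<Omega>)" "integrable (lebesgue_on \<Omega>) (\<lambda>x. (u x)\<^sup>2)"
    using weak_grad_works[OF H1] by (auto simp: has_weak_gradient_def L2_def)
  have "integrable (lebesgue_on \<Omega>) (\<lambda>x. (norm (weak_grad \<Omega> u x))\<^sup>2)"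
    using weak_grad_works[OF H1] by (auto simp: has_weak_gradient_def L2_def)
  then have grad0: "AE x in lebesgue_on \<Omega>. weak_grad \<Omega> u x = 0"
    using norm0 integral_nonneg_eq_0_iff_AE[of "lebesgue_on \<Omega>" "\<lambda>x. (norm (weak_grad \<Omega> u x))\<^sup>2"]
    by (simp add: H01_norm_def)
  have "(\<integral>x. (u x)\<^sup>2 \<partial>lebesgue_on \<Omega>) \<le> 0 + e" if "e > 0" for e
  proof -
    \<comment> \<open>Chosen to absorb twice the approximation error, \<open>2 * \<epsilon>\<close>,
      and twice the Poincare bound \<open>4 * R\<^sup>2 * \<epsilon>\<close>.\<close>
    define \<epsilon> where "\<epsilon> = e / (2 + 8 * R\<^sup>2)"
    have pos: "2 + 8 * R\<^sup>2 > 0" by (simp add: add_pos_nonneg)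
    then have "\<epsilon> > 0" using that by (simp add: \<epsilon>_def)
    then obtain \<phi> where \<phi>: "\<phi> \<in> test_functions \<Omega>" and
      lt: "(\<integral>x. (u x - \<phi> x)\<^sup>2 \<partial>lebesgue_on \<Omega>) +
        (\<integral>x. (norm (weak_grad \<Omega> u x - gradient \<phi> x))\<^sup>2 \<partial>lebesgue_on \<Omega>) < \<epsilon>" (is "?A + ?B < _")
      using assms(3) unfolding H01_def by blast
    note cont = test_functions_continuous[OF \<phi>] test_functions_gradient_continuous_vec[OF \<phi>]
    have meas: "\<phi> \<in> borel_measurable (lebesgue_on \<Omega>)" "gradient \<phi> \<in> borel_measurable (lebesgue_on \<Omega>)"
      using int[OF cont(1)] int[OF cont(2)] by simp_all
    have "?B = (\<integral>x. (norm (gradient \<phi> x))\<^sup>2 \<partial>lebesgue_on \<Omega>)"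
    proof (rule integral_cong_AE)
      show "AE x in lebesgue_on \<Omega>. (norm (weak_grad \<Omega> u x - gradient \<phi> x))\<^sup>2 = (norm (gradient \<phi> x))\<^sup>2"
        using grad0 by eventually_elim simp
    qed (use meas weak_grad_measurable[OF H1] in simp_all)
    moreover have "0 \<le> ?A" "0 \<le> (\<integral>x. (norm (gradient \<phi> x))\<^sup>2 \<partial>lebesgue_on \<Omega>)"
      by simp_all
    ultimately have "(\<integral>x. (norm (gradient \<phi> x))\<^sup>2 \<partial>lebesgue_on \<Omega>) \<le> \<epsilon>" and A: "?A \<le> \<epsilon>"
      using lt by linarith+
    then have "4 * R\<^sup>2 * (\<integral>x. (norm (gradient \<phi> x))\<^sup>2 \<partial>lebesgue_on \<Omega>) \<le> 4 * R\<^sup>2 * \<epsilon>"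
      by (intro mult_left_mono) auto
    then have phi: "(\<integral>x. (\<phi> x)\<^sup>2 \<partial>lebesgue_on \<Omega>) \<le> 4 * R\<^sup>2 * \<epsilon>"
      using poincare_test_functions[OF \<open>open \<Omega>\<close> R \<phi>] by linarith
    have int_phi: "integrable (lebesgue_on \<Omega>) (\<lambda>x. (\<phi> x)\<^sup>2)"
      by (intro int continuous_intros cont)
    \<comment> \<open>A non-integrable function has integral 0 by default, so smallness of
      \<open>?A\<close> is informative only together with this.\<close>
    have int_diff: "integrable (lebesgue_on \<Omega>) (\<lambda>x. (u x - \<phi> x)\<^sup>2)"
    proof (rule Bochner_Integration.integrable_bound)
      show "integrable (lebesgue_on \<Omega>) (\<lambda>x. 2 * (u x)\<^sup>2 + 2 * (\<phi> x)\<^sup>2)"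
        using u int_phi by simp
      show "AE x in lebesgue_on \<Omega>. norm ((u x - \<phi> x)\<^sup>2) \<le> norm (2 * (u x)\<^sup>2 + 2 * (\<phi> x)\<^sup>2)"
      proof (rule AE_I2)
        fix x
        have "0 \<le> (u x + \<phi> x)\<^sup>2" by simp
        then have "(u x - \<phi> x)\<^sup>2 \<le> 2 * (u x)\<^sup>2 + 2 * (\<phi> x)\<^sup>2"
          by (simp add: power2_sum power2_diff)
        then show "norm ((u x - \<phi> x)\<^sup>2) \<le> norm (2 * (u x)\<^sup>2 + 2 * (\<phi> x)\<^sup>2)"
          by simp
      qed
    qed (use u meas in simp)
    have "(\<integral>x. (u x)\<^sup>2 \<partial>lebesgue_on \<Omega>) \<le> (\<integral>x. 2 * (u x - \<phi> x)\<^sup>2 + 2 * (\<phi> x)\<^sup>2 \<partial>lebesgue_on \<Omega>)"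
    proof (rule integral_mono)
      fix x
      have "0 \<le> (u x - 2 * \<phi> x)\<^sup>2" by simp
      then show "(u x)\<^sup>2 \<le> 2 * (u x - \<phi> x)\<^sup>2 + 2 * (\<phi> x)\<^sup>2"
        by (simp add: power2_diff)
    qed (use u int_diff int_phi in simp_all)
    also have "\<dots> = 2 * ?A + 2 * (\<integral>x. (\<phi> x)\<^sup>2 \<partial>lebesgue_on \<Omega>)"
      using int_diff int_phi by simp
    also have "\<dots> \<le> (2 + 8 * R\<^sup>2) * \<epsilon>" using A phi by (simp add: algebra_simps)
    also have "\<dots> = e" using pos by (simp add: \<epsilon>_def)
    finally show ?thesis by simp
  qed
  then have "(\<integral>x. (u x)\<^sup>2 \<partial>lebesgue_on \<Omega>) \<le> 0" by (rule field_le_epsilon)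
  moreover have "0 \<le> (\<integral>x. (u x)\<^sup>2 \<partial>lebesgue_on \<Omega>)" by simp
  ultimately have "(\<integral>x. (u x)\<^sup>2 \<partial>lebesgue_on \<Omega>) = 0" by linarith
  then show ?thesis
    using integral_nonneg_eq_0_iff_AE[OF u(2)] by (simp add: zero_on_def)
qed

subsection \<open>The functional along rays\<close>

text \<open>No integrability of \<open>\<bar>u\<bar> powr \<gamma>\<close> is assumed: pulling out
  the constant remains valid when the integrals take the default value 0.\<close>

lemma Phi_cmult:
  assumes "open \<Omega>" "bounded \<Omega>" "u \<in> H1 \<Omega>" "\<gamma> \<noteq> 0"
  shows "Phi \<Omega> a \<gamma> lam (\<lambda>x. c * u x) = a / 2 * (c\<^sup>2 * (H01_norm \<Omega> u)\<^sup>2)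
    + lam / 4 * (c ^ 4 * (H01_norm \<Omega> u) ^ 4)
    - 1 / \<gamma> * (\<bar>c\<bar> powr \<gamma> * (\<integral>x. \<bar>u x\<bar> powr \<gamma> \<partial>lebesgue_on \<Omega>))"
proof -
  have nonneg: "0 \<le> (\<integral>x. \<bar>u x\<bar> powr \<gamma> \<partial>lebesgue_on \<Omega>)" by simp
  have "(\<integral>x. \<bar>c * u x\<bar> powr \<gamma> \<partial>lebesgue_on \<Omega>) = \<bar>c\<bar> powr \<gamma> * (\<integral>x. \<bar>u x\<bar> powr \<gamma> \<partial>lebesgue_on \<Omega>)"
    by (simp add: abs_mult powr_mult)
  then have "(Lp_norm \<Omega> \<gamma> (\<lambda>x. c * u x)) powr \<gamma> = \<bar>c\<bar> powr \<gamma> * (\<integral>x. \<bar>u x\<bar> powr \<gamma> \<partial>lebesgue_on \<Omega>)"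
    using nonneg \<open>\<gamma> \<noteq> 0\<close> by (simp add: Lp_norm_def powr_powr)
  then show ?thesis
    by (simp add: Phi_def H01_norm_cmult[OF assms(1-3)] power_mult_distrib power_even_abs)
qed

text \<open>The derivative at 1 of the functional along the ray through \<open>u\<close> is computed
  twice: it is 0 by criticality, and explicit from homogeneity.\<close>

lemma critical_point_Nehari:
  assumes "open \<Omega>" "bounded \<Omega>" "\<gamma> > 0"
    and crit: "critical_point \<Omega> (Phi \<Omega> a \<gamma> lam) u" and N: "H01_norm \<Omega> u > 0"
  shows "a * (H01_norm \<Omega> u)\<^sup>2 + lam * (H01_norm \<Omega> u) ^ 4 = (\<integral>x. \<bar>u x\<bar> powr \<gamma> \<partial>lebesgue_on \<Omega>)"
proof -
  define N where "N = H01_norm \<Omega> u"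
  define P where "P = (\<integral>x. \<bar>u x\<bar> powr \<gamma> \<partial>lebesgue_on \<Omega>)"
  define F where "F = Phi \<Omega> a \<gamma> lam"
  define f where "f s = F (\<lambda>x. s * u x)" for s
  have H01: "u \<in> H01 \<Omega>" and H1: "u \<in> H1 \<Omega>"
    using crit by (auto simp: critical_point_def H01_def)
  have "N > 0" using N by (simp add: N_def)
  have "(f has_real_derivative 0) (at 1)"
    unfolding DERIV_def
  proof (rule LIM_I)
    fix r :: real assume "r > 0"
    \<comment> \<open>The increment \<open>t * u\<close> has norm \<open>\<bar>t\<bar> * N\<close>,
      hence the division by \<open>N\<close>; the factor 2 turns the non-strict bound of the
      derivative into the strict one required of a limit.\<close>
    then have "r / (2 * N) > 0" using \<open>N > 0\<close> by simp
    then obtain \<delta> where "\<delta> > 0" and \<delta>: "\<And>h. h \<in> H01 \<Omega> \<Longrightarrow> H01_norm \<Omega> h < \<delta> \<Longrightarrow>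
        \<bar>F (\<lambda>x. u x + h x) - F u - 0\<bar> \<le> r / (2 * N) * H01_norm \<Omega> h"
      using crit unfolding critical_point_def has_H01_derivative_def F_def by blast
    show "\<exists>s>0. \<forall>x. x \<noteq> 0 \<and> norm (x - 0) < s \<longrightarrow> norm ((f (1 + x) - f 1) / x - 0) < r"
    proof (intro exI[of _ "\<delta> / N"] conjI allI impI)
      show "0 < \<delta> / N" using \<open>\<delta> > 0\<close> \<open>N > 0\<close> by simp
      fix t :: real assume t: "t \<noteq> 0 \<and> norm (t - 0) < \<delta> / N"
      have Nt: "H01_norm \<Omega> (\<lambda>x. t * u x) = \<bar>t\<bar> * N"
        using H01_norm_cmult[OF assms(1,2) H1] by (simp add: N_def)
      have "\<bar>t\<bar> * N < \<delta>" using t \<open>N > 0\<close> by (simp add: pos_less_divide_eq)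
      then have "\<bar>F (\<lambda>x. u x + t * u x) - F u - 0\<bar> \<le> r / (2 * N) * (\<bar>t\<bar> * N)"
        using \<delta>[OF H01_cmult[OF assms(1,2) H01], of t] Nt by simp
      moreover have "F (\<lambda>x. u x + t * u x) = f (1 + t)" "F u = f 1"
        by (simp_all add: f_def distrib_right)
      ultimately have "\<bar>f (1 + t) - f 1\<bar> \<le> r / 2 * \<bar>t\<bar>"
        using \<open>N > 0\<close> by simp
      also have "\<dots> < r * \<bar>t\<bar>" using t \<open>r > 0\<close> by simp
      finally show "norm ((f (1 + t) - f 1) / t - 0) < r"
        using t by (simp add: abs_divide pos_divide_less_eq)
    qed
  qed
  moreover have "(f has_real_derivative a * N\<^sup>2 + lam * N ^ 4 - P) (at 1)"
  proof -
    define k where "k s = a / 2 * (s\<^sup>2 * N\<^sup>2) + lam / 4 * (s ^ 4 * N ^ 4) - 1 / \<gamma> * (s powr \<gamma> * P)" for s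
    have "(k has_real_derivative a * N\<^sup>2 + lam * N ^ 4 - P) (at 1)"
      unfolding k_def using \<open>\<gamma> > 0\<close> by (auto intro!: derivative_eq_intros)
    moreover have "f s = k s" if "s > 0" for s
      unfolding f_def F_def k_def N_def P_def
      using Phi_cmult[OF assms(1,2) H1, of \<gamma> a lam s] that \<open>\<gamma> > 0\<close> by simp
    then have "\<forall>\<^sub>F s in nhds 1. f s = k s"
      using eventually_nhds_in_open[of "{0<..}" "1::real"] by (auto elim!: eventually_mono)
    ultimately show ?thesis by (subst DERIV_cong_ev[OF refl _ refl])
  qed
  ultimately have "0 = a * N\<^sup>2 + lam * N ^ 4 - P" by (rule DERIV_unique)
  then show ?thesis by (simp add: N_def P_def)
qed

text \<open>Weighted AM-GM with weights \<open>(4 - \<gamma>) / 2\<close> and \<open>(\<gamma> - 2) / 2\<close>; these make the geometric mean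
  homogeneous of degree \<open>\<gamma>\<close> in \<open>N\<close>.\<close>

lemma Nehari_imp_le_C_const:
  fixes a lam \<gamma> N P :: real
  assumes "a > 0" "lam > 0" "N > 0" "2 < \<gamma>" "\<gamma> < 4" and P: "a * N\<^sup>2 + lam * N ^ 4 = P"
  shows "lam \<le> C_const a \<gamma> * (P powr (1 / \<gamma>) / N) powr (2 * \<gamma> / (\<gamma> - 2))"
proof -
  define \<theta> where "\<theta> = (4 - \<gamma>) / 2"
  define \<eta> where "\<eta> = (\<gamma> - 2) / 2"
  have pos: "\<theta> > 0" "\<eta> > 0" "\<theta> + \<eta> = 1" using assms by (auto simp: \<theta>_def \<eta>_def field_simps)
  have exps: "2 / (\<gamma> - 2) = 1 / \<eta>" "2 * \<gamma> / (\<gamma> - 2) = \<gamma> / \<eta>" and \<gamma>: "\<gamma> = 2 + 2 * \<eta>"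
    using assms by (auto simp: \<eta>_def field_simps)
  \<comment> \<open>Dividing by the weights makes the weighted arithmetic mean of \<open>X\<close>
    and \<open>Y\<close> equal to \<open>P\<close>.\<close>
  define X where "X = a * N\<^sup>2 / \<theta>"
  define Y where "Y = lam * N ^ 4 / \<eta>"
  have XY: "X > 0" "Y > 0" using assms pos by (auto simp: X_def Y_def)
  \<comment> \<open>When \<open>P\<close> is an integral, this excludes the default value 0 of a
    non-integrable integrand.\<close>
  have "0 < P" using assms by (auto simp flip: P intro!: add_pos_pos)
  have "X powr \<theta> * Y powr \<eta> \<le> \<theta> * X + \<eta> * Y"
    using pos XY by (intro Youngs_inequality_0) auto
  also have "\<dots> = P" using pos P by (simp add: X_def Y_def)
  \<comment> \<open>The exponent \<open>1 / \<eta>\<close> reduces the power of \<open>Y\<close> to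
    1, so that \<open>lam\<close> enters linearly and can be isolated.\<close>
  finally have "(X powr \<theta> * Y powr \<eta>) powr (1 / \<eta>) \<le> P powr (1 / \<eta>)"
    using pos XY by (intro powr_mono2) auto
  moreover have "(X powr \<theta> * Y powr \<eta>) powr (1 / \<eta>) = X powr (\<theta> / \<eta>) * Y"
    using pos XY by (simp add: powr_mult powr_powr)
  ultimately have le: "X powr (\<theta> / \<eta>) * Y \<le> P powr (1 / \<eta>)" by simp
  have inv: "1 / \<eta> = 1 + \<theta> / \<eta>" using pos by (simp add: field_simps)
  have C: "C_const a \<gamma> = a * (\<eta> / \<theta>) * (\<theta> / a) powr (1 / \<eta>)"
    using assms by (simp add: C_const_def exps) (simp add: \<eta>_def \<theta>_def)
  have Npow: "(N\<^sup>2) powr (\<theta> / \<eta>) * N ^ 4 = N powr (\<gamma> / \<eta>)"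
  proof -
    have "(N\<^sup>2) powr (\<theta> / \<eta>) * N ^ 4 = N powr (2 * (\<theta> / \<eta>)) * N powr 4"
      using \<open>N > 0\<close> by (simp add: powr_powr flip: powr_numeral)
    also have "\<dots> = N powr (2 * (\<theta> / \<eta>) + 4)" by (simp add: powr_add)
    also have "2 * (\<theta> / \<eta>) + 4 = \<gamma> / \<eta>" using pos \<gamma> by (simp add: field_simps)
    finally show ?thesis .
  qed
  have aX: "(\<theta> / a) powr (\<theta> / \<eta>) * X powr (\<theta> / \<eta>) = (N\<^sup>2) powr (\<theta> / \<eta>)"
  proof -
    have "\<theta> / a * X = N\<^sup>2" using assms pos by (simp add: X_def)
    then show ?thesis using assms pos XY by (simp flip: powr_mult)
  qed
  \<comment> \<open>Isolating \<open>lam\<close> leaves exactly the constant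
    \<open>C_const a \<gamma>\<close>, because \<open>1 / \<eta> = 1 + \<theta> / \<eta>\<close>
    splits off one factor \<open>\<theta> / a\<close>, and the powers of \<open>N\<close> add up to
    \<open>\<gamma> / \<eta>\<close>.\<close>
  have "lam * N powr (\<gamma> / \<eta>) = a * (\<eta> / \<theta>) * (\<theta> / a) * ((\<theta> / a) powr (\<theta> / \<eta>) * X powr (\<theta> / \<eta>)) * Y"
    unfolding aX Npow[symmetric] Y_def using assms pos by simp
  also have "\<dots> = C_const a \<gamma> * (X powr (\<theta> / \<eta>) * Y)"
    using assms pos unfolding C inv powr_add by simp
  also have "\<dots> \<le> C_const a \<gamma> * P powr (1 / \<eta>)"
    using le assms pos by (intro mult_left_mono) (auto simp: C)
  finally have "lam \<le> C_const a \<gamma> * (P powr (1 / \<eta>) / N powr (\<gamma> / \<eta>))"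
    using \<open>N > 0\<close> by (simp add: field_simps)
  also have "P powr (1 / \<eta>) / N powr (\<gamma> / \<eta>) = (P powr (1 / \<gamma>) / N) powr (\<gamma> / \<eta>)"
    using \<open>N > 0\<close> \<open>P > 0\<close> assms by (simp add: powr_divide powr_powr)
  finally show ?thesis by (simp add: exps)
qed

theorem corollary2p6:
  fixes \<Omega> :: "(real^3) set" and a \<gamma> lam :: real
  assumes "bounded_regular_domain \<Omega>"
    and "a > 0"
    and "2 < \<gamma>" and "\<gamma> < 4"
    and "lam > 0"
    and "ereal lam > lambda_star \<Omega> a \<gamma>"
  shows "\<forall>u. critical_point \<Omega> (Phi \<Omega> a \<gamma> lam) u \<longrightarrow> zero_on \<Omega> u"
proof (intro allI impI, rule ccontr)
  fix u assume crit: "critical_point \<Omega> (Phi \<Omega> a \<gamma> lam) u" and nz: "\<not> zero_on \<Omega> u"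
  have \<Omega>: "open \<Omega>" "bounded \<Omega>" using assms(1) by (auto simp: bounded_regular_domain_def)
  have u: "u \<in> H01 \<Omega>" using crit by (simp add: critical_point_def)
  have "H01_norm \<Omega> u \<noteq> 0" using H01_norm_zero_imp_zero_on[OF \<Omega> u] nz by blast
  then have N: "H01_norm \<Omega> u > 0"
    by (simp add: H01_norm_def less_le)
  have "lam \<le> lambda_of \<Omega> a \<gamma> u"
    unfolding lambda_of_def Lp_norm_def
    using critical_point_Nehari[OF \<Omega> _ crit N] N assms(2-5)
    by (intro Nehari_imp_le_C_const) auto
  moreover have "ereal (lambda_of \<Omega> a \<gamma> u) \<le> lambda_star \<Omega> a \<gamma>"
    unfolding lambda_star_def using u nz by (intro SUP_upper) auto
  ultimately show False using assms(6) by (metis ereal_less_eq(3) leD order_trans)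
qed

end
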